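(* Let $d \ge 2$ and $1 \le k \le d-1$ be integers. Then there is no Lebesgue measurable set $S \subseteq \mathbb{R}^d$ which has the Steinhaus property with respect to $\mathbb{Z}^k \times \{0\}^{d-k}$.
   Context: For a (countable) set $\Gamma \subseteq \mathbb{R}^d$, a Lebesgue measurable set $S \subseteq \mathbb{R}^d$ has the Steinhaus property with respect to $\Gamma$ if for every $T \in O(d)$ (the orthogonal group) $S + T(\Gamma)$ is a tiling of $\mathbb{R}^d$. Tiling is understood in the almost everywhere sense: $S + T(\Gamma)$ is a tiling if almost every $x \in \mathbb{R}^d$ (Lebesgue measure) belongs to exactly one of the translates $S + n$, $n \in T(\Gamma)$, i.e. $\sum_{n \in T(\Gamma)} \mathbf{1}_S(x-n) = 1$ for almost every $x \in \mathbb{R}^d$. *)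

theory Defs
  imports "HOL-Analysis.Analysis"
begin

definition tiling :: "'a::euclidean_space set \<Rightarrow> 'a set \<Rightarrow> bool" where
  "tiling S \<Lambda> \<longleftrightarrow> (AE x in lebesgue. \<exists>!n. n \<in> \<Lambda> \<and> x \<in> (\<lambda>s. s + n) ` S)"

text \<open>
  Translates are counted by their index, so equal translates belonging to different
  elements of the translation set count separately.  The next lemma states this as
  an equation between sums of indicator functions.
\<close>

lemma tiling_iff_has_sum:
  fixes S \<Lambda> :: "'a::euclidean_space set"
  shows "tiling S \<Lambda> \<longleftrightarrow>
    (AE x in lebesgue. ((\<lambda>n. indicator S (x - n) :: real) has_sum 1) \<Lambda>)"
proof -
  have mem: "x \<in> (\<lambda>s. s + n) ` S \<longleftrightarrow> x - n \<in> S" for x n :: 'a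
  proof
    assume "x - n \<in> S"
    then have "(x - n) + n \<in> (\<lambda>s. s + n) ` S" by (rule imageI)
    then show "x \<in> (\<lambda>s. s + n) ` S" by simp
  qed auto
  have eq: "(\<exists>!n. n \<in> \<Lambda> \<and> x - n \<in> S) \<longleftrightarrow>
      ((\<lambda>n. indicator S (x - n) :: real) has_sum 1) \<Lambda>" (is "?L \<longleftrightarrow> (?f has_sum 1) \<Lambda>") for x
  proof
    assume ?L
    then obtain n where n: "n \<in> \<Lambda>" "x - n \<in> S" and
      uniq: "\<And>m. m \<in> \<Lambda> \<Longrightarrow> x - m \<in> S \<Longrightarrow> m = n" by blast
    have zero: "?f m = 0" if "m \<in> \<Lambda> - {n}" for m
      using uniq[of m] that by (cases "x - m \<in> S") auto
    have "(?f has_sum sum ?f {n}) {n}" by (rule has_sum_finite) simp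
    moreover have "(?f has_sum 1) {n} \<longleftrightarrow> (?f has_sum 1) \<Lambda>"
      by (rule has_sum_cong_neutral) (use n(1) zero in auto)
    ultimately show "(?f has_sum 1) \<Lambda>" using n by simp
  next
    assume hs: "(?f has_sum 1) \<Lambda>"
    have "\<exists>n\<in>\<Lambda>. x - n \<in> S"
    proof (rule ccontr)
      assume "\<not> ?thesis"
      then have "(?f has_sum 0) \<Lambda>" by (intro has_sum_0) auto
      from has_sum_unique[OF hs this] show False by simp
    qed
    moreover have "m = n" if "m \<in> \<Lambda>" "n \<in> \<Lambda>" "x - m \<in> S" "x - n \<in> S" for m n
    proof (rule ccontr)
      assume "m \<noteq> n"
      moreover have "sum ?f {m, n} \<le> 1"
        by (rule finite_sum_le_has_sum[OF hs]) (use that in auto)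
      ultimately show False using that by simp
    qed
    ultimately show ?L by blast
  qed
  show ?thesis unfolding tiling_def mem eq ..
qed

definition steinhaus :: "'a::euclidean_space set \<Rightarrow> 'a set \<Rightarrow> bool" where
  "steinhaus \<Gamma> S \<longleftrightarrow> (\<forall>T. orthogonal_transformation T \<longrightarrow> tiling S (T ` \<Gamma>))"

text \<open>
  The index type of a vector carries no order, so \<open>\<int>\<^sup>k \<times> {0}\<^sup>d\<^sup>-\<^sup>k\<close> is
  taken with respect to an enumeration \<open>e 1, \<dots>, e d\<close> of the coordinates, where
  \<open>d = CARD('n)\<close>.
\<close>

definition int_lattice :: "(nat \<Rightarrow> 'n::finite) \<Rightarrow> nat \<Rightarrow> (real ^ 'n) set" where
  "int_lattice e k =
    {x. (\<forall>i\<in>{1..k}. x $ e i \<in> \<int>) \<and> (\<forall>i\<in>{k+1..CARD('n)}. x $ e i = 0)}"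

end

theory Submission
  imports Defs
begin

text \<open>
  Write the lattice as \<open>\<int>a + \<Lambda>\<close> with \<open>\<Lambda>\<close> orthogonal to \<open>a\<close> and to a further
  unit vector \<open>b \<bottom> a\<close>; this is where \<open>k < d\<close> enters.  Let \<open>G\<close> be the sum of the
  translates of the indicator function of \<open>S\<close> by \<open>\<Lambda>\<close>.  For a unit vector \<open>v\<close> in the
  plane of \<open>a\<close> and \<open>b\<close>, rotating \<open>a\<close> to \<open>v\<close> fixes \<open>\<Lambda>\<close>, so the tiling property says
  that \<open>G\<close> has sum 1 over almost every coset of \<open>\<int>v\<close>, and hence integral 1 over almost
  every line in direction \<open>v\<close>.  On almost every translate of the plane this gives a function
  \<open>h \<ge> 0\<close> on \<open>\<real>\<^sup>2\<close>, and averaging over all lines through a point \<open>p\<close> shows that the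
  potential \<open>\<integral> h(y) / |y - p| dy\<close> is a finite positive constant for almost every \<open>p\<close>.  But the
  average of such a potential over a disc of radius \<open>R\<close> is at most a constant times
  \<open>\<integral> h(y) min(1/R, 1/|y|) dy\<close>, which tends to 0 by dominated convergence as
  \<open>R \<rightarrow> \<infinity>\<close>.
\<close>

section \<open>Null sets, translations and sums over cosets of the integers\<close>

lemma AE_lborel_translate:
  fixes c :: "'a::euclidean_space"
  assumes "AE x in lborel. P x"
  shows "AE x in lborel. P (x + c)"
proof -
  have "AE x in distr lborel borel ((+) c). P x"
    using assms by (simp only: lborel_distr_plus)
  from AE_distrD[OF _ this] show ?thesis
    by (simp add: add.commute)
qed

text \<open>Fubini for null sets: the joint exceptional set is measurable with null sections in one
  direction, hence in the other for almost every section.\<close>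

lemma AE_lborel_swap:
  fixes P :: "'a::euclidean_space \<Rightarrow> 'b::euclidean_space \<Rightarrow> bool"
  assumes "Measurable.pred (borel \<Otimes>\<^sub>M borel) (\<lambda>(x, y). P x y)"
    and "\<And>x. AE y in lborel. P x y"
  shows "AE y in lborel. AE x in lborel. P x y"
proof -
  have "{z \<in> space (lborel \<Otimes>\<^sub>M lborel). P (fst z) (snd z)} \<in> sets (lborel \<Otimes>\<^sub>M lborel)"
    using assms(1) by (simp add: pred_def case_prod_unfold space_pair_measure cong: sets_pair_measure_cong)
  from lborel_pair.AE_commute[OF this] assms(2) show ?thesis by auto
qed

text \<open>Each real lies in exactly one interval \<open>[m, m + 1)\<close>, so the indicators of
  these intervals sum to 1; Tonelli and the shift by \<open>m\<close> do the rest.\<close>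

lemma nn_integral_real_unfold:
  fixes f :: "real \<Rightarrow> ennreal"
  assumes [measurable]: "f \<in> borel_measurable borel"
  shows "(\<integral>\<^sup>+t. f t \<partial>lborel) =
    (\<integral>\<^sup>+t\<in>{0..<1}. (\<integral>\<^sup>+m. f (t + of_int m) \<partial>count_space UNIV) \<partial>lborel)"
proof -
  let ?I = "indicator {0..<1::real} :: real \<Rightarrow> ennreal"
  have one: "(\<integral>\<^sup>+m. ?I (t - of_int m) \<partial>count_space UNIV) = 1" for t :: real
  proof -
    have "?I (t - of_int m) = indicator {\<lfloor>t\<rfloor>} m" for m :: int
      by (auto simp: indicator_def floor_eq_iff; linarith)
    then show ?thesis by simp
  qed
  have "(\<integral>\<^sup>+t\<in>{0..<1}. (\<integral>\<^sup>+m. f (t + of_int m) \<partial>count_space UNIV) \<partial>lborel) =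
      (\<integral>\<^sup>+t. (\<integral>\<^sup>+m. f (t + of_int m) * ?I t \<partial>count_space UNIV) \<partial>lborel)"
    by (simp add: nn_integral_multc)
  also have "\<dots> = (\<integral>\<^sup>+m. (\<integral>\<^sup>+t. f (t + of_int m) * ?I t \<partial>lborel) \<partial>count_space (UNIV :: int set))"
    by (intro nn_integral_count_space_nn_integral) auto
  also have "\<dots> = (\<integral>\<^sup>+m. (\<integral>\<^sup>+t. f t * ?I (t - of_int m) \<partial>lborel) \<partial>count_space (UNIV :: int set))"
  proof (rule nn_integral_cong)
    show "(\<integral>\<^sup>+t. f (t + of_int m) * ?I t \<partial>lborel) = (\<integral>\<^sup>+t. f t * ?I (t - of_int m) \<partial>lborel)"
      for m :: int
      by (subst nn_integral_real_affine[where c = 1 and t = "of_int m" and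
            f = "\<lambda>t. f t * ?I (t - of_int m)"]) (auto simp: add.commute)
  qed
  also have "\<dots> = (\<integral>\<^sup>+t. (\<integral>\<^sup>+m. f t * ?I (t - of_int m) \<partial>count_space (UNIV :: int set)) \<partial>lborel)"
    by (intro nn_integral_count_space_nn_integral[symmetric]) auto
  also have "\<dots> = (\<integral>\<^sup>+t. f t \<partial>lborel)"
    by (simp add: nn_integral_cmult one)
  finally show ?thesis ..
qed

lemma borel_measurable_nn_integral_count_space:
  fixes f :: "'i \<Rightarrow> 'a \<Rightarrow> ennreal"
  assumes "countable A" and "\<And>i. i \<in> A \<Longrightarrow> f i \<in> borel_measurable M"
  shows "(\<lambda>x. \<integral>\<^sup>+i. f i x \<partial>count_space A) \<in> borel_measurable M"
proof -
  interpret sigma_finite_measure "count_space A"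
    by (rule sigma_finite_measure_count_space_countable) fact
  have "(\<lambda>(i, x). f i x) \<in> borel_measurable (count_space A \<Otimes>\<^sub>M M)"
    by (rule measurable_pair_measure_countable1) (use assms in auto)
  then have "(\<lambda>(x, i). f i x) \<in> borel_measurable (M \<Otimes>\<^sub>M count_space A)"
    by (subst measurable_pair_swap_iff) (simp add: case_prod_unfold)
  then show ?thesis by (rule borel_measurable_nn_integral)
qed

text \<open>For each fixed \<open>t\<close>, translation invariance carries the hypothesis over to
  the base point \<open>x + t *\<^sub>R v\<close>, and Fubini then lets a single \<open>x\<close>
  serve almost all \<open>t\<close>. Unfolding the line over \<open>{0..<1}\<close> leaves the
  integral of the constant 1 over that interval.\<close>

lemma AE_line_integral_eq_1:
  fixes G :: "'a::euclidean_space \<Rightarrow> ennreal"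
  assumes [measurable]: "G \<in> borel_measurable borel"
    and sum: "AE x in lborel. (\<integral>\<^sup>+m. G (x + of_int m *\<^sub>R v) \<partial>count_space UNIV) = 1"
  shows "AE x in lborel. (\<integral>\<^sup>+t. G (x + t *\<^sub>R v) \<partial>lborel) = 1"
proof -
  have [measurable]: "(\<lambda>x. \<integral>\<^sup>+m. G (x + of_int m *\<^sub>R v) \<partial>count_space (UNIV :: int set)) \<in> borel_measurable borel"
    by (rule borel_measurable_nn_integral_count_space) auto
  have "AE x in lborel. AE t in lborel.
      (\<integral>\<^sup>+m. G ((x + t *\<^sub>R v) + of_int m *\<^sub>R v) \<partial>count_space UNIV) = 1"
  proof (rule AE_lborel_swap)
    show "AE x in lborel. (\<integral>\<^sup>+m. G ((x + t *\<^sub>R v) + of_int m *\<^sub>R v) \<partial>count_space UNIV) = 1" for t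
      by (rule AE_lborel_translate[OF sum])
  qed measurable
  then show ?thesis
  proof eventually_elim
    case (elim x)
    have "(\<integral>\<^sup>+t. G (x + t *\<^sub>R v) \<partial>lborel) =
        (\<integral>\<^sup>+t\<in>{0..<1}. (\<integral>\<^sup>+m. G ((x + t *\<^sub>R v) + of_int m *\<^sub>R v) \<partial>count_space UNIV) \<partial>lborel)"
      by (subst nn_integral_real_unfold) (simp_all add: algebra_simps)
    also have "\<dots> = (\<integral>\<^sup>+t. indicator {0..<1::real} t \<partial>lborel)"
      using elim by (intro nn_integral_cong_AE) auto
    finally show ?case by simp
  qed
qed

section \<open>Polar coordinates in the plane, parametrised by slope\<close>

text \<open>The unit vector \<open>(cos \<theta>, sin \<theta>)\<close> with
  \<open>s = tan \<theta>\<close> and angle strictly between \<open>-pi/2\<close> and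
  \<open>pi/2\<close>; the vertical direction that is left out is negligible.\<close>

abbreviation slope_vector :: "real \<Rightarrow> real \<times> real" where
  "slope_vector s \<equiv> (1 / sqrt (1 + s\<^sup>2)) *\<^sub>R (1, s)"

lemma norm_slope_vector: "norm (slope_vector s) = 1"
proof -
  have "0 < 1 + s\<^sup>2" by (simp add: add_pos_nonneg)
  moreover have "norm (1 :: real, s) = sqrt (1 + s\<^sup>2)" by (simp add: norm_Pair)
  ultimately show ?thesis by (simp only: norm_scaleR) simp
qed

text \<open>
  Polar coordinates, with the direction of a line given by its slope \<open>s = tan \<theta>\<close>;
  hence \<open>d\<theta> = ds / (1 + s\<^sup>2)\<close>, and negative \<open>t\<close> covers the opposite directions.
\<close>

lemma nn_integral_polar:
  fixes \<phi> :: "real \<times> real \<Rightarrow> ennreal"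
  assumes [measurable]: "\<phi> \<in> borel_measurable borel"
  shows "(\<integral>\<^sup>+q. \<phi> q * ennreal (1 / norm q) \<partial>lborel) =
    (\<integral>\<^sup>+s. ennreal (1 / (1 + s\<^sup>2)) * (\<integral>\<^sup>+t. \<phi> (t *\<^sub>R slope_vector s) \<partial>lborel) \<partial>lborel)"
proof -
  have [measurable]: "\<phi> \<in> borel_measurable (borel \<Otimes>\<^sub>M borel)"
    using assms by (simp add: borel_prod)
  have pos: "0 < 1 + s\<^sup>2" for s :: real by (simp add: add_pos_nonneg)
  \<comment> \<open>Substituting \<open>u = t * s\<close> brings out the Jacobian factor
    \<open>|t|\<close>, which cancels the factor \<open>|t|\<close> of the norm.\<close>
  have inner: "(\<integral>\<^sup>+u. \<phi> (t, u) * ennreal (1 / norm (t, u)) \<partial>lborel) =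
      (\<integral>\<^sup>+s. \<phi> (t, t * s) * ennreal (1 / sqrt (1 + s\<^sup>2)) \<partial>lborel)" if "t \<noteq> 0" for t
  proof -
    have n: "norm (t, t * s) = \<bar>t\<bar> * sqrt (1 + s\<^sup>2)" for s
    proof -
      have "t\<^sup>2 + (t * s)\<^sup>2 = t\<^sup>2 * (1 + s\<^sup>2)" by (simp add: power_mult_distrib distrib_left)
      then show ?thesis by (simp add: norm_Pair real_sqrt_mult)
    qed
    have e: "ennreal \<bar>t\<bar> * (\<phi> (t, t * s) * ennreal (1 / norm (t, t * s))) =
        \<phi> (t, t * s) * ennreal (1 / sqrt (1 + s\<^sup>2))" for s
    proof -
      have "ennreal \<bar>t\<bar> * ennreal (1 / norm (t, t * s)) = ennreal (1 / sqrt (1 + s\<^sup>2))"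
        unfolding n using that by (simp flip: ennreal_mult)
      then show ?thesis by (subst mult.left_commute) simp
    qed
    have "(\<integral>\<^sup>+u. \<phi> (t, u) * ennreal (1 / norm (t, u)) \<partial>lborel) =
        (\<integral>\<^sup>+s. ennreal \<bar>t\<bar> * (\<phi> (t, t * s) * ennreal (1 / norm (t, t * s))) \<partial>lborel)"
      using that by (subst nn_integral_real_affine[where c = t and t = 0]) (simp_all add: nn_integral_cmult)
    then show ?thesis unfolding e .
  qed
  \<comment> \<open>Rescaling \<open>t\<close> by \<open>r = 1 / sqrt (1 + s^2)\<close> makes the
    direction a unit vector; its Jacobian is the second factor in
    \<open>r * r = 1 / (1 + s^2)\<close>.\<close>
  have outer: "(\<integral>\<^sup>+t. \<phi> (t, t * s) * ennreal (1 / sqrt (1 + s\<^sup>2)) \<partial>lborel) =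
      ennreal (1 / (1 + s\<^sup>2)) * (\<integral>\<^sup>+t. \<phi> (t *\<^sub>R slope_vector s) \<partial>lborel)" for s
  proof -
    define r where "r = 1 / sqrt (1 + s\<^sup>2)"
    have r: "r > 0" "r * r = 1 / (1 + s\<^sup>2)" using pos[of s] by (simp_all add: r_def)
    have "(\<integral>\<^sup>+t. \<phi> (t, t * s) * ennreal r \<partial>lborel) =
        ennreal r * (\<integral>\<^sup>+t. \<phi> (r * t, r * t * s) * ennreal r \<partial>lborel)"
      using r by (subst nn_integral_real_affine[where c = r and t = 0]) simp_all
    also have "(\<integral>\<^sup>+t. \<phi> (r * t, r * t * s) * ennreal r \<partial>lborel) =
        (\<integral>\<^sup>+t. \<phi> (r * t, r * t * s) \<partial>lborel) * ennreal r"
      by (rule nn_integral_multc) simp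
    also have "ennreal r * ((\<integral>\<^sup>+t. \<phi> (r * t, r * t * s) \<partial>lborel) * ennreal r) =
        ennreal (r * r) * (\<integral>\<^sup>+t. \<phi> (r * t, r * t * s) \<partial>lborel)"
      using r(1) by (simp add: ennreal_mult mult_ac)
    finally show ?thesis unfolding r by (simp add: r_def mult_ac)
  qed
  have "(\<lambda>q. \<phi> q * ennreal (1 / norm q)) \<in> borel_measurable (lborel \<Otimes>\<^sub>M lborel)"
    unfolding lborel_prod by simp
  note [measurable] = this
  have "(\<integral>\<^sup>+q. \<phi> q * ennreal (1 / norm q) \<partial>(lborel \<Otimes>\<^sub>M lborel)) =
      (\<integral>\<^sup>+t. (\<integral>\<^sup>+u. \<phi> (t, u) * ennreal (1 / norm (t, u)) \<partial>lborel) \<partial>lborel)"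
    by (subst lborel.nn_integral_fst[where f = "\<lambda>q. \<phi> q * ennreal (1 / norm q)", symmetric]) simp_all
  then have "(\<integral>\<^sup>+q. \<phi> q * ennreal (1 / norm q) \<partial>lborel) =
      (\<integral>\<^sup>+t. (\<integral>\<^sup>+u. \<phi> (t, u) * ennreal (1 / norm (t, u)) \<partial>lborel) \<partial>lborel)"
    unfolding lborel_prod .
  also have "\<dots> = (\<integral>\<^sup>+t. (\<integral>\<^sup>+s. \<phi> (t, t * s) * ennreal (1 / sqrt (1 + s\<^sup>2)) \<partial>lborel) \<partial>lborel)"
    by (intro nn_integral_cong_AE, use AE_lborel_singleton[of 0] in eventually_elim) (rule inner)
  also have "\<dots> = (\<integral>\<^sup>+s. (\<integral>\<^sup>+t. \<phi> (t, t * s) * ennreal (1 / sqrt (1 + s\<^sup>2)) \<partial>lborel) \<partial>lborel)"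
    by (rule lborel_pair.Fubini'[symmetric, where f = "\<lambda>t s. \<phi> (t, t * s) * ennreal (1 / sqrt (1 + s\<^sup>2))"]) simp
  finally show ?thesis unfolding outer .
qed

text \<open>The angle swept by a half turn, that is, pi. What matters below is that it is finite and
  nonzero.\<close>

abbreviation slope_mass :: ennreal where
  "slope_mass \<equiv> \<integral>\<^sup>+s. ennreal (1 / (1 + s\<^sup>2)) \<partial>lborel"

lemma slope_mass_finite: "slope_mass < \<infinity>"
proof -
  let ?f = "\<lambda>s::real. ennreal (1 / (1 + s\<^sup>2))"
  have half: "(\<integral>\<^sup>+s. ?f s * indicator {0..} s \<partial>lborel) = ennreal (pi / 2 - arctan 0)"
    by (rule nn_integral_FTC_atLeast)
      (auto intro!: derivative_eq_intros tendsto_arctan_at_top simp: field_simps)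
  \<comment> \<open>Both half lines contain 0, so the splitting is stated as an inequality.\<close>
  have "slope_mass \<le> (\<integral>\<^sup>+s. ?f s * indicator {0..} s + ?f (- s) * indicator {0..} (- s) \<partial>lborel)"
    by (intro nn_integral_mono) (auto simp: indicator_def)
  also have "\<dots> = (\<integral>\<^sup>+s. ?f s * indicator {0..} s \<partial>lborel) + (\<integral>\<^sup>+s. ?f (- s) * indicator {0..} (- s) \<partial>lborel)"
    by (rule nn_integral_add) auto
  also have "(\<integral>\<^sup>+s. ?f (- s) * indicator {0..} (- s) \<partial>lborel) = (\<integral>\<^sup>+s. ?f s * indicator {0..} s \<partial>lborel)"
    by (subst (2) nn_integral_real_affine[where c = "-1" and t = 0]) auto
  also have "(\<integral>\<^sup>+s. ?f s * indicator {0..} s \<partial>lborel) + (\<integral>\<^sup>+s. ?f s * indicator {0..} s \<partial>lborel) < \<infinity>"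
    unfolding half by simp
  finally show ?thesis .
qed

lemma slope_mass_nonzero: "slope_mass \<noteq> 0"
proof
  assume "slope_mass = 0"
  then have "AE s in lborel. ennreal (1 / (1 + s\<^sup>2)) = (0::ennreal)"
    by (subst (asm) nn_integral_0_iff_AE) auto
  moreover have "ennreal (1 / (1 + s\<^sup>2)) \<noteq> 0" for s :: real
    using add_pos_nonneg[of 1 "s\<^sup>2"] by simp
  ultimately have "AE s in (lborel :: real measure). False" by simp
  then show False
    by (simp add: eventually_False ae_filter_eq_bot_iff)
qed

text \<open>The polar Jacobian cancels the singularity at 0, and every line through 0 meets the disc
  in a segment of length \<open>2 * r\<close>.\<close>

lemma nn_integral_cball_inverse_norm:
  assumes "0 \<le> r"
  shows "(\<integral>\<^sup>+q\<in>cball (0 :: real \<times> real) r. ennreal (1 / norm q) \<partial>lborel) = ennreal (2 * r) * slope_mass"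
proof -
  have ind: "indicator (cball 0 r) (t *\<^sub>R slope_vector s) = (indicator {-r..r} t :: ennreal)" for t s
    unfolding indicator_def mem_cball dist_0_norm norm_scaleR[of t "slope_vector s"] norm_slope_vector by auto
  have [measurable]: "cball (0 :: real \<times> real) r \<in> sets borel" by simp
  have "(\<integral>\<^sup>+q\<in>cball (0 :: real \<times> real) r. ennreal (1 / norm q) \<partial>lborel) =
      (\<integral>\<^sup>+q. indicator (cball 0 r) q * ennreal (1 / norm (q :: real \<times> real)) \<partial>lborel)"
    by (simp add: mult.commute)
  also have "\<dots> = (\<integral>\<^sup>+s. ennreal (1 / (1 + s\<^sup>2)) * ennreal (2 * r) \<partial>lborel)"
    using assms by (subst nn_integral_polar, measurable) (simp only: ind, simp)
  also have "\<dots> = slope_mass * ennreal (2 * r)"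
    by (rule nn_integral_multc) simp
  finally show ?thesis by (simp only: mult.commute)
qed

section \<open>Planar potentials with kernel 1 / norm\<close>

lemma nn_integral_lborel_translate:
  fixes f :: "'a::euclidean_space \<Rightarrow> ennreal"
  assumes [measurable]: "f \<in> borel_measurable borel"
  shows "(\<integral>\<^sup>+x. f (c + x) \<partial>lborel) = (\<integral>\<^sup>+x. f x \<partial>lborel)"
proof -
  have "(\<integral>\<^sup>+x. f x \<partial>distr lborel borel ((+) c)) = (\<integral>\<^sup>+x. f (c + x) \<partial>lborel)"
    by (rule nn_integral_distr) auto
  then show ?thesis by (simp only: lborel_distr_plus)
qed

lemma AE_lborel_ex:
  assumes "AE x in (lborel :: 'a::euclidean_space measure). P x"
  shows "\<exists>x. P x"
  by (rule eventually_happens'[OF _ assms]) (simp add: ae_filter_eq_bot_iff)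

text \<open>If \<open>norm y \<le> 2 * R\<close>, the disc lies in the disc of radius
  \<open>3 * R\<close> around \<open>y\<close>, which gives \<open>6 * R * D\<close>; otherwise the
  kernel is at most \<open>2 / norm y\<close> on the disc, whose area is \<open>pi * R^2\<close>.
  The constant \<open>12 * D + 2 * pi\<close> covers both cases. The origin is excluded because
  \<open>1 / norm y\<close> is 0 there.\<close>

lemma nn_integral_cball_inverse_dist_le:
  fixes y :: "real \<times> real"
  assumes "0 < R" and "y \<noteq> 0" and D: "slope_mass = ennreal D" "0 \<le> D"
  shows "(\<integral>\<^sup>+p\<in>cball 0 R. ennreal (1 / norm (y - p)) \<partial>lborel)
    \<le> ennreal (R\<^sup>2 * ((12 * D + 2 * pi) * min (1 / R) (1 / norm y)))"
proof (cases "norm y \<le> 2 * R")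
  case True
  have [measurable]: "cball (0 :: real \<times> real) r \<in> sets borel" for r by simp
  have "(\<integral>\<^sup>+p\<in>cball 0 R. ennreal (1 / norm (y - p)) \<partial>lborel) \<le>
      (\<integral>\<^sup>+p. ennreal (1 / norm (- y + p)) * indicator (cball 0 (3 * R)) (- y + p) \<partial>lborel)"
  proof (rule nn_integral_mono)
    fix p :: "real \<times> real"
    have "norm (- y + p) \<le> 3 * R" if "norm p \<le> R"
      using norm_triangle_ineq[of "- y" p] that True by simp
    then show "ennreal (1 / norm (y - p)) * indicator (cball 0 R) p \<le>
        ennreal (1 / norm (- y + p)) * indicator (cball 0 (3 * R)) (- y + p)"
      by (auto simp: indicator_def norm_minus_commute)
  qed
  also have "\<dots> = (\<integral>\<^sup>+p\<in>cball 0 (3 * R). ennreal (1 / norm (p :: real \<times> real)) \<partial>lborel)"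
    by (rule nn_integral_lborel_translate) measurable
  also have "\<dots> = ennreal (6 * R * D)"
    using assms(1) D by (subst nn_integral_cball_inverse_norm) (simp_all add: ennreal_mult[symmetric])
  also have "\<dots> \<le> ennreal (R\<^sup>2 * ((12 * D + 2 * pi) * min (1 / R) (1 / norm y)))"
  proof (rule ennreal_leI)
    have "1 / (2 * R) \<le> min (1 / R) (1 / norm y)"
      using True assms(1,2) by (simp add: field_simps)
    then have "R\<^sup>2 * ((12 * D + 2 * pi) * (1 / (2 * R))) \<le> R\<^sup>2 * ((12 * D + 2 * pi) * min (1 / R) (1 / norm y))"
      using D(2) by (intro mult_left_mono) auto
    moreover have "6 * R * D \<le> R\<^sup>2 * ((12 * D + 2 * pi) * (1 / (2 * R)))"
      using assms(1) by (simp add: field_simps power2_eq_square)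
    ultimately show "6 * R * D \<le> R\<^sup>2 * ((12 * D + 2 * pi) * min (1 / R) (1 / norm y))" by linarith
  qed
  finally show ?thesis .
next
  case False
  then have y: "2 * R < norm y" "0 < norm y" using assms(1) by auto
  have "(\<integral>\<^sup>+p\<in>cball 0 R. ennreal (1 / norm (y - p)) \<partial>lborel) \<le>
      (\<integral>\<^sup>+p. ennreal (2 / norm y) * indicator (cball 0 R) (p :: real \<times> real) \<partial>lborel)"
  proof (rule nn_integral_mono)
    fix p :: "real \<times> real"
    have "1 / norm (y - p) \<le> 2 / norm y" if "norm p \<le> R"
    proof -
      have "norm y / 2 \<le> norm (y - p)"
        using norm_triangle_ineq2[of y p] that y by linarith
      moreover from this have "0 < norm (y - p)" using y by linarith
      ultimately have "1 / norm (y - p) \<le> 1 / (norm y / 2)"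
        using y by (intro divide_left_mono mult_pos_pos) linarith+
      then show ?thesis by simp
    qed
    then show "ennreal (1 / norm (y - p)) * indicator (cball 0 R) p \<le>
        ennreal (2 / norm y) * indicator (cball 0 R) p"
      by (auto simp: indicator_def intro!: ennreal_leI)
  qed
  also have "\<dots> = ennreal (2 / norm y * (pi * R\<^sup>2))"
    using assms(1) y by (simp add: nn_integral_cmult_indicator emeasure_cball unit_ball_vol_2 power2_eq_square ennreal_mult[symmetric])
  also have "\<dots> \<le> ennreal (R\<^sup>2 * ((12 * D + 2 * pi) * min (1 / R) (1 / norm y)))"
  proof (rule ennreal_leI)
    have "1 / norm y \<le> 1 / R" using y assms(1) by (simp add: field_simps)
    then have min_eq: "min (1 / R) (1 / norm y) = 1 / norm y" by simp
    show "2 / norm y * (pi * R\<^sup>2) \<le> R\<^sup>2 * ((12 * D + 2 * pi) * min (1 / R) (1 / norm y))"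
      unfolding min_eq using y D(2) by (simp add: field_simps)
  qed
  finally show ?thesis .
qed

lemma constant_inverse_norm_potential_eq_0:
  fixes h :: "real \<times> real \<Rightarrow> ennreal"
  assumes [measurable]: "h \<in> borel_measurable borel"
    and pot: "AE p in lborel. (\<integral>\<^sup>+q. h (p + q) * ennreal (1 / norm q) \<partial>lborel) = C"
    and "C < \<infinity>"
  shows "C = 0"
proof -
  have [measurable]: "cball (0 :: real \<times> real) r \<in> sets borel" for r by simp
  obtain D where D: "slope_mass = ennreal D" "0 \<le> D"
    using slope_mass_finite by (cases slope_mass) auto
  define M where "M = 12 * D + 2 * pi"
  have M: "0 \<le> M" using D(2) by (simp add: M_def)
  \<comment> \<open>Recentring at a point where the potential is exactly \<open>C\<close> turns
    finiteness of \<open>C\<close> into integrability of \<open>g y / norm y\<close>, which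
    dominates the limit below.\<close>
  obtain p0 where p0: "(\<integral>\<^sup>+q. h (p0 + q) * ennreal (1 / norm q) \<partial>lborel) = C"
    using AE_lborel_ex[OF pot] by blast
  define g where "g y = h (p0 + y)" for y
  have [measurable]: "g \<in> borel_measurable borel" unfolding g_def by measurable
  have g0: "(\<integral>\<^sup>+y. g y * ennreal (1 / norm y) \<partial>lborel) = C"
    using p0 by (simp add: g_def)
  have g_pot: "AE p in lborel. (\<integral>\<^sup>+y. g y * ennreal (1 / norm (y - p)) \<partial>lborel) = C"
    using AE_lborel_translate[OF pot, of p0]
  proof eventually_elim
    case (elim p)
    have "(\<integral>\<^sup>+y. g y * ennreal (1 / norm (y - p)) \<partial>lborel) =
        (\<integral>\<^sup>+y. g (p + y) * ennreal (1 / norm (p + y - p)) \<partial>lborel)"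
      by (rule nn_integral_lborel_translate[symmetric]) measurable
    with elim show ?case by (simp add: g_def add_ac)
  qed
  \<comment> \<open>Finiteness of \<open>g y\<close> is what makes its product with a null sequence
    tend to 0. The origin is set aside because \<open>1 / norm 0 = 0\<close> gives no information
    there.\<close>
  have g_finite: "AE y in lborel. g y \<noteq> \<infinity>"
  proof -
    have "AE y in lborel. g y * ennreal (1 / norm y) \<noteq> \<infinity>"
      by (rule nn_integral_noteq_infinite) (use g0 assms(3) in auto)
    then show ?thesis
      using AE_lborel_singleton[of "0 :: real \<times> real"]
      by eventually_elim (auto simp: ennreal_top_mult)
  qed
  \<comment> \<open>The potential is integrated over the disc of radius \<open>R\<close>; Tonelli
    moves this integration onto the kernel, and the factor \<open>R^2\<close> cancels from both
    sides.\<close>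
  have bound: "C * ennreal pi \<le> (\<integral>\<^sup>+y. g y * ennreal (M * min (1 / R) (1 / norm y)) \<partial>lborel)"
    if "0 < R" for R :: real
  proof -
    let ?I = "indicator (cball 0 R) :: real \<times> real \<Rightarrow> ennreal"
    have "C * ennreal (pi * R\<^sup>2) = (\<integral>\<^sup>+p. C * ?I p \<partial>lborel)"
      using that by (simp add: nn_integral_cmult_indicator emeasure_cball unit_ball_vol_2 power2_eq_square)
    also have "\<dots> = (\<integral>\<^sup>+p. (\<integral>\<^sup>+y. g y * ennreal (1 / norm (y - p)) \<partial>lborel) * ?I p \<partial>lborel)"
      using g_pot by (intro nn_integral_cong_AE) auto
    also have "\<dots> = (\<integral>\<^sup>+p. (\<integral>\<^sup>+y. g y * (ennreal (1 / norm (y - p)) * ?I p) \<partial>lborel) \<partial>lborel)"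
      by (simp add: nn_integral_multc[symmetric] mult.assoc)
    also have "\<dots> = (\<integral>\<^sup>+y. (\<integral>\<^sup>+p. g y * (ennreal (1 / norm (y - p)) * ?I p) \<partial>lborel) \<partial>lborel)"
      by (rule lborel_pair.Fubini'[where f = "\<lambda>y p. g y * (ennreal (1 / norm (y - p)) * ?I p)"]) measurable
    also have "\<dots> = (\<integral>\<^sup>+y. g y * (\<integral>\<^sup>+p\<in>cball 0 R. ennreal (1 / norm (y - p)) \<partial>lborel) \<partial>lborel)"
      by (intro nn_integral_cong nn_integral_cmult) measurable
    also have "\<dots> \<le> (\<integral>\<^sup>+y. g y * ennreal (R\<^sup>2 * (M * min (1 / R) (1 / norm y))) \<partial>lborel)"
    proof (rule nn_integral_mono_AE)
      show "AE y in lborel. g y * (\<integral>\<^sup>+p\<in>cball 0 R. ennreal (1 / norm (y - p)) \<partial>lborel) \<le>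
          g y * ennreal (R\<^sup>2 * (M * min (1 / R) (1 / norm y)))"
        using AE_lborel_singleton[of "0 :: real \<times> real"]
        by eventually_elim (auto intro!: mult_left_mono nn_integral_cball_inverse_dist_le that D simp: M_def)
    qed
    also have "\<dots> = (\<integral>\<^sup>+y. ennreal (R\<^sup>2) * (g y * ennreal (M * min (1 / R) (1 / norm y))) \<partial>lborel)"
      using M that by (simp add: ennreal_mult mult.left_commute)
    also have "\<dots> = ennreal (R\<^sup>2) * (\<integral>\<^sup>+y. g y * ennreal (M * min (1 / R) (1 / norm y)) \<partial>lborel)"
      by (rule nn_integral_cmult) measurable
    finally have "ennreal (R\<^sup>2) * (C * ennreal pi) \<le>
        ennreal (R\<^sup>2) * (\<integral>\<^sup>+y. g y * ennreal (M * min (1 / R) (1 / norm y)) \<partial>lborel)"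
      by (simp add: ennreal_mult mult_ac)
    then show ?thesis using that by (subst (asm) ennreal_mult_le_mult_iff) auto
  qed
  have "(\<lambda>n. \<integral>\<^sup>+y. g y * ennreal (M * min (1 / real (Suc n)) (1 / norm y)) \<partial>lborel)
      \<longlonglongrightarrow> (\<integral>\<^sup>+y. 0 \<partial>(lborel :: (real \<times> real) measure))"
  proof (rule nn_integral_dominated_convergence)
    show "(\<integral>\<^sup>+y. ennreal M * (g y * ennreal (1 / norm y)) \<partial>lborel) < \<infinity>"
      using assms(3) g0 by (subst nn_integral_cmult) (auto simp: ennreal_mult_less_top)
    show "AE y in lborel. g y * ennreal (M * min (1 / real (Suc n)) (1 / norm y)) \<le>
        ennreal M * (g y * ennreal (1 / norm y))" for n
    proof (rule AE_I2)
      fix y :: "real \<times> real"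
      have "g y * ennreal (M * min (1 / real (Suc n)) (1 / norm y)) \<le> g y * ennreal (M * (1 / norm y))"
        by (intro mult_left_mono ennreal_leI M) auto
      then show "g y * ennreal (M * min (1 / real (Suc n)) (1 / norm y)) \<le>
          ennreal M * (g y * ennreal (1 / norm y))"
        using M by (simp only: ennreal_mult divide_nonneg_nonneg norm_ge_zero zero_le_one mult.left_commute)
    qed
    show "AE y in lborel. (\<lambda>n. g y * ennreal (M * min (1 / real (Suc n)) (1 / norm y))) \<longlonglongrightarrow> 0"
      using g_finite
    proof eventually_elim
      case (elim y)
      have "(\<lambda>n. M * min (1 / real (Suc n)) (1 / norm y)) \<longlonglongrightarrow> M * min 0 (1 / norm y)"
        by (intro tendsto_intros LIMSEQ_Suc lim_1_over_n)
      then have "(\<lambda>n. ennreal (M * min (1 / real (Suc n)) (1 / norm y))) \<longlonglongrightarrow> ennreal 0"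
        by (intro tendsto_ennrealI) simp
      then show ?case
        using elim ennreal_tendsto_cmult[of "g y"] by (fastforce simp: less_top)
    qed
  qed measurable
  then have "C * ennreal pi \<le> 0"
    by (intro LIMSEQ_le_const[where a = "C * ennreal pi"]) (use bound in \<open>auto simp del: of_nat_Suc\<close>)
  then show ?thesis using pi_gt_zero by (simp add: ennreal_eq_0_iff)
qed

section \<open>Reduction to a plane\<close>

text \<open>Restricting \<open>G\<close> to a suitable translate of the plane of \<open>a\<close>
  and \<open>b\<close> and weighting the lines through a point by \<open>1 / (1 + s^2)\<close> gives
  a potential equal to \<open>slope_mass\<close> almost everywhere, hence a finite nonzero
  constant.\<close>

lemma not_all_line_integrals_eq_1:
  fixes G :: "'a::euclidean_space \<Rightarrow> ennreal"
  assumes [measurable]: "G \<in> borel_measurable borel"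
    and lines: "\<And>s. AE x in lborel.
      (\<integral>\<^sup>+t. G (x + t *\<^sub>R ((1 / sqrt (1 + s\<^sup>2)) *\<^sub>R (a + s *\<^sub>R b))) \<partial>lborel) = 1"
  shows False
proof -
  let ?L = "\<lambda>p :: real \<times> real. fst p *\<^sub>R a + snd p *\<^sub>R b"
  have L: "?L (p + t *\<^sub>R slope_vector s) =
      ?L p + t *\<^sub>R ((1 / sqrt (1 + s\<^sup>2)) *\<^sub>R (a + s *\<^sub>R b))" for p t s
    by (simp add: algebra_simps)
  have [measurable]: "?L \<in> borel_measurable borel"
    by (intro borel_measurable_continuous_onI continuous_intros)
  have nz: "1 + s\<^sup>2 \<noteq> 0" for s :: real
    using add_pos_nonneg[of 1 "s\<^sup>2"] by simp
  \<comment> \<open>The nested tuple \<open>q\<close> stands for \<open>(((p, s), x), t)\<close>;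
    joint continuity supplies the measurability that Fubini requires.\<close>
  have "continuous_on UNIV (\<lambda>q :: (((real \<times> real) \<times> real) \<times> 'a) \<times> real.
      snd (fst q) + ?L (fst (fst (fst q)) + snd q *\<^sub>R slope_vector (snd (fst (fst q)))))"
    by (intro continuous_intros) (auto simp: nz)
  then have "(\<lambda>q :: (((real \<times> real) \<times> real) \<times> 'a) \<times> real.
      snd (fst q) + ?L (fst (fst (fst q)) + snd q *\<^sub>R slope_vector (snd (fst (fst q)))))
      \<in> borel \<Otimes>\<^sub>M borel \<rightarrow>\<^sub>M borel"
    unfolding borel_prod by (rule borel_measurable_continuous_onI)
  then have "(\<lambda>(w :: ((real \<times> real) \<times> real) \<times> 'a, t).
      G (snd w + ?L (fst (fst w) + t *\<^sub>R slope_vector (snd (fst w)))))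
      \<in> borel_measurable (borel \<Otimes>\<^sub>M lborel)"
    by (simp add: case_prod_unfold)
  from lborel.borel_measurable_nn_integral[OF this]
  have [measurable]: "(\<lambda>w :: ((real \<times> real) \<times> real) \<times> 'a.
      \<integral>\<^sup>+t. G (snd w + ?L (fst (fst w) + t *\<^sub>R slope_vector (snd (fst w)))) \<partial>lborel)
      \<in> borel_measurable (borel \<Otimes>\<^sub>M borel)"
    unfolding borel_prod .
  \<comment> \<open>Here \<open>z = (p, s)\<close> collects a base point and a slope. For fixed
    \<open>z\<close> the claim is a translate of the hypothesis; exchanging the quantifiers yields
    one \<open>x\<close> that is good for almost all \<open>z\<close> at once.\<close>
  have "AE x in lborel. AE z in lborel.
      (\<integral>\<^sup>+t. G (x + ?L (fst z + t *\<^sub>R slope_vector (snd z))) \<partial>lborel) = 1"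
  proof (rule AE_lborel_swap)
    show "AE x in lborel. (\<integral>\<^sup>+t. G (x + ?L (fst z + t *\<^sub>R slope_vector (snd z))) \<partial>lborel) = 1"
      for z :: "(real \<times> real) \<times> real"
      using AE_lborel_translate[OF lines, of "?L (fst z)" "snd z"]
      unfolding L by (simp only: add.assoc)
  qed measurable
  then obtain x where x: "AE z in lborel.
      (\<integral>\<^sup>+t. G (x + ?L (fst z + t *\<^sub>R slope_vector (snd z))) \<partial>lborel) = 1"
    using AE_lborel_ex by blast
  define h where "h p = G (x + ?L p)" for p
  have [measurable]: "h \<in> borel_measurable borel" unfolding h_def by measurable
  have "AE z in lborel \<Otimes>\<^sub>M lborel. (\<integral>\<^sup>+t. h (fst z + t *\<^sub>R slope_vector (snd z)) \<partial>lborel) = 1"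
    using x unfolding lborel_prod h_def .
  then have "AE p in lborel. AE s in lborel. (\<integral>\<^sup>+t. h (p + t *\<^sub>R slope_vector s) \<partial>lborel) = 1"
    by (drule_tac lborel_pair.AE_pair) simp
  then have "AE p in lborel. (\<integral>\<^sup>+q. h (p + q) * ennreal (1 / norm q) \<partial>lborel) = slope_mass"
  proof eventually_elim
    case (elim p)
    have "(\<integral>\<^sup>+q. h (p + q) * ennreal (1 / norm q) \<partial>lborel) =
        (\<integral>\<^sup>+s. ennreal (1 / (1 + s\<^sup>2)) * (\<integral>\<^sup>+t. h (p + t *\<^sub>R slope_vector s) \<partial>lborel) \<partial>lborel)"
      by (rule nn_integral_polar) measurable
    also have "\<dots> = slope_mass"
      using elim by (intro nn_integral_cong_AE) auto
    finally show ?case .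
  qed
  from constant_inverse_norm_potential_eq_0[OF _ this slope_mass_finite] slope_mass_nonzero
  show False by simp
qed

section \<open>Plane rotations and the tiling condition\<close>

text \<open>The rotation with cosine \<open>c\<close> and sine \<open>d\<close> in the plane of
  \<open>a\<close> and \<open>b\<close>. Written as the identity plus a correction, it visibly fixes
  every vector orthogonal to that plane.\<close>

lemma orthogonal_transformation_plane_rotation:
  fixes a b :: "'a::euclidean_space"
  assumes "norm a = 1" "norm b = 1" "a \<bullet> b = 0" and cs: "c\<^sup>2 + d\<^sup>2 = 1"
  shows "orthogonal_transformation (\<lambda>x. x + ((c - 1) * (x \<bullet> a) - d * (x \<bullet> b)) *\<^sub>R a
    + (d * (x \<bullet> a) + (c - 1) * (x \<bullet> b)) *\<^sub>R b)"
    (is "orthogonal_transformation ?T")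
  unfolding orthogonal_transformation
proof
  show "linear ?T"
    by (rule linearI) (simp_all add: algebra_simps inner_add_left)
  show "\<forall>x. norm (?T x) = norm x"
  proof
    fix x
    have ab: "a \<bullet> a = 1" "b \<bullet> b = 1" "a \<bullet> b = 0" "b \<bullet> a = 0"
      using assms by (simp_all add: norm_eq_1 inner_commute)
    have "?T x \<bullet> ?T x - x \<bullet> x = (c\<^sup>2 + d\<^sup>2 - 1) * ((x \<bullet> a)\<^sup>2 + (x \<bullet> b)\<^sup>2)"
      by (simp add: inner_add_left inner_add_right ab inner_commute[of a x] inner_commute[of b x])
        (simp add: algebra_simps power2_eq_square)
    then show "norm (?T x) = norm x"
      using cs by (simp add: norm_eq_sqrt_inner)
  qed
qed

lemma not_steinhaus_if_orthogonal_lattice: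
  fixes a b :: "'a::euclidean_space" and \<Lambda> S :: "'a set"
  assumes a: "norm a = 1" and b: "norm b = 1" and ab: "a \<bullet> b = 0"
    and \<Lambda>: "countable \<Lambda>" "\<And>n. n \<in> \<Lambda> \<Longrightarrow> n \<bullet> a = 0" "\<And>n. n \<in> \<Lambda> \<Longrightarrow> n \<bullet> b = 0"
    and S: "S \<in> sets lebesgue"
  shows "\<not> steinhaus ((\<lambda>(m :: int, n). of_int m *\<^sub>R a + n) ` (UNIV \<times> \<Lambda>)) S"
proof
  let ?\<Gamma> = "(\<lambda>(m :: int, n). of_int m *\<^sub>R a + n) ` (UNIV \<times> \<Lambda>)"
  assume steinhaus: "steinhaus ?\<Gamma> S"
  \<comment> \<open>A Borel set that agrees with \<open>S\<close> up to a null set, so that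
    \<open>G\<close> becomes Borel measurable.\<close>
  define B where "B = main_part lborel S"
  have [measurable]: "B \<in> sets borel"
    using S main_part_sets[of S lborel] by (simp add: B_def)
  have S_B: "S = B \<union> null_part lborel S"
    using S main_part_null_part_Un[of S lborel] by (simp add: B_def)
  define G :: "'a \<Rightarrow> ennreal" where "G x = (\<integral>\<^sup>+n. indicator B (x - n) \<partial>count_space \<Lambda>)" for x
  have [measurable]: "G \<in> borel_measurable borel"
    unfolding G_def by (rule borel_measurable_nn_integral_count_space[OF \<Lambda>(1)]) measurable
  \<comment> \<open>Translation by \<open>n\<close> enters as \<open>x - n\<close>, so the sums run
    in direction \<open>- v\<close>; negating \<open>a\<close> and \<open>b\<close> produces exactly
    this direction.\<close>
  have "AE x in lborel. (\<integral>\<^sup>+t. G (x + t *\<^sub>R ((1 / sqrt (1 + s\<^sup>2)) *\<^sub>R (- a + s *\<^sub>R (- b)))) \<partial>lborel) = 1" for s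
  proof (rule AE_line_integral_eq_1)
    define c d where "c = 1 / sqrt (1 + s\<^sup>2)" and "d = s / sqrt (1 + s\<^sup>2)"
    define T where "T x = x + ((c - 1) * (x \<bullet> a) - d * (x \<bullet> b)) *\<^sub>R a
      + (d * (x \<bullet> a) + (c - 1) * (x \<bullet> b)) *\<^sub>R b" for x
    define v where "v = c *\<^sub>R a + d *\<^sub>R b"
    have pos: "0 < 1 + s\<^sup>2" by (simp add: add_pos_nonneg)
    have v: "(1 / sqrt (1 + s\<^sup>2)) *\<^sub>R (- a + s *\<^sub>R (- b)) = - v"
      by (simp add: v_def c_def d_def algebra_simps)
    have "c\<^sup>2 + d\<^sup>2 = (1 + s\<^sup>2) / (1 + s\<^sup>2)"
      unfolding c_def d_def power_divide add_divide_distrib using pos by simp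
    then have cd: "c\<^sup>2 + d\<^sup>2 = 1" using pos by simp
    have T: "orthogonal_transformation T"
      unfolding T_def using a b ab cd by (rule orthogonal_transformation_plane_rotation)
    have T_\<Gamma>: "T (of_int m *\<^sub>R a + n) = of_int m *\<^sub>R v + n" if "n \<in> \<Lambda>" for m :: int and n
      using that a ab \<Lambda>(2,3)
      by (simp add: T_def v_def inner_add_left norm_eq_1 algebra_simps)
    have T_image: "T ` ?\<Gamma> = (\<lambda>(m :: int, n). of_int m *\<^sub>R v + n) ` (UNIV \<times> \<Lambda>)"
      unfolding image_image by (rule image_cong) (auto simp: T_\<Gamma>)
    \<comment> \<open>Distinct pairs give distinct lattice points, so the unique translate
      containing \<open>x\<close> singles out one pair. Undoing the rotation and taking the
      component along \<open>a\<close> recovers \<open>m\<close>.\<close>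
    have inj: "m = m' \<and> n = n'"
      if "of_int m *\<^sub>R v + n = of_int m' *\<^sub>R v + n'" "n \<in> \<Lambda>" "n' \<in> \<Lambda>" for m m' :: int and n n'
    proof -
      have "T (of_int m *\<^sub>R a + n) = T (of_int m' *\<^sub>R a + n')" using that by (simp add: T_\<Gamma>)
      then have eq: "of_int m *\<^sub>R a + n = of_int m' *\<^sub>R a + n'"
        using orthogonal_transformation_inj[OF T] by (simp add: inj_eq)
      then have "(of_int m *\<^sub>R a + n) \<bullet> a = (of_int m' *\<^sub>R a + n') \<bullet> a" by simp
      then have "m = m'" using that a \<Lambda>(2) by (auto simp: inner_add_left norm_eq_1)
      then show ?thesis using eq by simp
    qed
    have "countable (T ` ?\<Gamma>)" using \<Lambda>(1) by simp
    moreover have "AE x in lborel. x - n \<notin> null_part lborel S" for n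
      using AE_lborel_translate[OF AE_notin_null_part[OF S], of "- n"] by simp
    \<comment> \<open>Only countably many null sets have to be avoided, so \<open>S\<close> and
      \<open>B\<close> can be interchanged for all translates at once.\<close>
    ultimately have "AE x in lborel. \<forall>n\<in>T ` ?\<Gamma>. x - n \<notin> null_part lborel S"
      by (simp only: AE_ball_countable) simp
    moreover have "AE x in lborel. \<exists>!n. n \<in> T ` ?\<Gamma> \<and> x \<in> (\<lambda>s. s + n) ` S"
      using steinhaus T unfolding steinhaus_def tiling_def AE_completion_iff by blast
    ultimately have "AE x in lborel. (\<integral>\<^sup>+m. G (x + of_int m *\<^sub>R (- v)) \<partial>count_space UNIV) = 1"
    proof eventually_elim
      case (elim x)
      have mem: "x \<in> (\<lambda>s. s + n) ` S \<longleftrightarrow> x - n \<in> B" if "n \<in> T ` ?\<Gamma>" for n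
      proof -
        have "x \<in> (\<lambda>s. s + n) ` S \<longleftrightarrow> x - n \<in> S"
          by (auto intro: image_eqI[of _ _ "x - n"])
        then show ?thesis using elim(1) that S_B by blast
      qed
      obtain n where n: "n \<in> T ` ?\<Gamma>" "x - n \<in> B"
        and uniq: "\<And>n'. n' \<in> T ` ?\<Gamma> \<Longrightarrow> x - n' \<in> B \<Longrightarrow> n' = n"
        using elim(2) mem by metis
      obtain m0 n0 where n0: "n = of_int m0 *\<^sub>R v + n0" "n0 \<in> \<Lambda>"
        using n(1) unfolding T_image by auto
      have B_iff: "x + of_int m *\<^sub>R (- v) - n' \<in> B \<longleftrightarrow> m = m0 \<and> n' = n0" if "n' \<in> \<Lambda>" for m :: int and n'
      proof -
        have eq: "x + of_int m *\<^sub>R (- v) - n' = x - (of_int m *\<^sub>R v + n')" by simp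
        have "of_int m *\<^sub>R v + n' \<in> T ` ?\<Gamma>" unfolding T_image using that by auto
        then have "x - (of_int m *\<^sub>R v + n') \<in> B \<longleftrightarrow> of_int m *\<^sub>R v + n' = n"
          using uniq n(2) by blast
        also have "\<dots> \<longleftrightarrow> m = m0 \<and> n' = n0"
          unfolding n0(1) using inj[of m n' m0 n0] n0(2) that by blast
        finally show ?thesis unfolding eq .
      qed
      have "G (x + of_int m *\<^sub>R (- v)) = indicator {m0} m" for m
      proof -
        have "G (x + of_int m *\<^sub>R (- v)) = (\<integral>\<^sup>+n'. indicator {m0} m * indicator {n0} n' \<partial>count_space \<Lambda>)"
          unfolding G_def by (rule nn_integral_cong) (simp only: indicator_def B_iff space_count_space insert_iff empty_iff, simp)
        also have "\<dots> = indicator {m0} m * (\<integral>\<^sup>+n'. indicator {n0} n' \<partial>count_space \<Lambda>)"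
          by (rule nn_integral_cmult) simp
        also have "(\<integral>\<^sup>+n'. indicator {n0} n' \<partial>count_space \<Lambda>) = (1 :: ennreal)"
          using n0(2) by (subst nn_integral_indicator) auto
        finally show ?thesis by simp
      qed
      then show ?case by simp
    qed
    then show "AE x in lborel. (\<integral>\<^sup>+m. G (x + of_int m *\<^sub>R
        ((1 / sqrt (1 + s\<^sup>2)) *\<^sub>R (- a + s *\<^sub>R (- b)))) \<partial>count_space UNIV) = 1"
      unfolding v .
  qed measurable
  from not_all_line_integrals_eq_1[OF _ this] show False by simp
qed

section \<open>The integer lattice of rank k\<close>

theorem corollary1:
  fixes d k :: nat and e :: "nat \<Rightarrow> 'n::finite"
  assumes "CARD('n) = d" and "bij_betw e {1..d} UNIV"
    and "2 \<le> d" and "1 \<le> k" and "k \<le> d - 1"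
  shows "\<not> (\<exists>S :: (real ^ 'n) set. S \<in> sets lebesgue \<and> steinhaus (int_lattice e k) S)"
proof -
  \<comment> \<open>Coordinate \<open>k + 1\<close> exists because \<open>k < d\<close>, and all
    lattice points vanish there, so \<open>?b\<close> is orthogonal to the whole lattice. In
    \<open>?\<Lambda>\<close> only the coordinates 2 to \<open>k\<close> remain free.\<close>
  let ?a = "axis (e 1) 1 :: real ^ 'n" and ?b = "axis (e (k + 1)) 1 :: real ^ 'n"
  let ?\<Lambda> = "{x \<in> int_lattice e k. x $ e 1 = 0}"
  have kd: "k + 1 \<le> d" using assms(3,5) by linarith
  have e_inj: "e i = e j \<longleftrightarrow> i = j" if "i \<in> {1..d}" "j \<in> {1..d}" for i j
    using assms(2) that by (auto simp: bij_betw_def inj_on_eq_iff)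
  have e1: "e i \<noteq> e 1" if "i \<in> {k+1..d}" for i
    using that assms(3,4) by (subst e_inj) auto
  have "int_lattice e k \<subseteq> {x. \<forall>i. x $ i \<in> \<int>}"
  proof
    fix x assume x: "x \<in> int_lattice e k"
    have "x $ i \<in> \<int>" for i
    proof -
      obtain j where "j \<in> {1..d}" "i = e j" using assms(2) unfolding bij_betw_def by blast
      then show ?thesis using x assms(1) by (cases "j \<le> k") (auto simp: int_lattice_def)
    qed
    then show "x \<in> {x. \<forall>i. x $ i \<in> \<int>}" by simp
  qed
  moreover have "countable {x :: real ^ 'n. \<forall>i. x $ i \<in> \<int>}"
    by (rule countable_vector) (simp add: countable_int)
  ultimately have count: "countable ?\<Lambda>" by (auto intro: countable_subset)
  have lattice: "int_lattice e k = (\<lambda>(m :: int, n). of_int m *\<^sub>R ?a + n) ` (UNIV \<times> ?\<Lambda>)"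
  proof (intro equalityI subsetI)
    fix x assume x: "x \<in> int_lattice e k"
    then have "x $ e 1 \<in> \<int>" using assms(4) by (simp add: int_lattice_def)
    then obtain m :: int where m: "x $ e 1 = of_int m" by (rule Ints_cases)
    have "x - of_int m *\<^sub>R ?a \<in> ?\<Lambda>"
      using x m e1 assms(1) by (auto simp: int_lattice_def axis_def)
    then show "x \<in> (\<lambda>(m :: int, n). of_int m *\<^sub>R ?a + n) ` (UNIV \<times> ?\<Lambda>)"
      by (intro image_eqI[of _ _ "(m, x - of_int m *\<^sub>R ?a)"]) auto
  next
    fix x assume "x \<in> (\<lambda>(m :: int, n). of_int m *\<^sub>R ?a + n) ` (UNIV \<times> ?\<Lambda>)"
    then show "x \<in> int_lattice e k"
      using e1 assms(1) by (auto simp: int_lattice_def axis_def)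
  qed
  have "\<not> steinhaus (int_lattice e k) S" if "S \<in> sets lebesgue" for S
  proof (subst lattice, rule not_steinhaus_if_orthogonal_lattice)
    show "?a \<bullet> ?b = 0"
      using e1[of "k + 1"] kd by (auto simp: inner_axis_axis dest: sym)
    show "n \<bullet> ?b = 0" if "n \<in> ?\<Lambda>" for n
      using that assms(1) kd by (auto simp: int_lattice_def inner_axis)
  qed (use count that in \<open>auto simp: inner_axis\<close>)
  then show ?thesis by blast
qed

end
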